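(* Let $\mathsf{MLPS}_2$ be the set of all $(d_1,d_2)\in(0,1/2]^2$ such that for every pair $(s_1,s_2)$ of distinct positive integers there exists $t\in\mathbb{R}$ with $\|s_1 t\|\geq d_1$ and $\|s_2 t\|\geq d_2$. Then $$\mathsf{MLPS}_2=\left\{(d_1,d_2)\in(0,1/2]^2:\ 2d_1+d_2\leq 1\ \text{ and }\ d_1+2d_2\leq 1\right\}.$$
   Context: For $x\in\mathbb{R}$, $\|x\|:=\min_{m\in\mathbb{Z}}|x-m|$ denotes the distance from $x$ to the nearest integer. The set $\mathsf{MLPS}_2$ is called the two-dimensional mixed loneliness parameter space. *)

theory Defs
  imports Complex_Main
begin

definition dist_int :: "real \<Rightarrow> real"
  where "dist_int x = (INF m::int. \<bar>x - of_int m\<bar>)"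

(* The infimum is attained, so it is the minimum over the integers. *)
lemma dist_int_eq_round: "dist_int x = \<bar>x - of_int (round x)\<bar>"
  unfolding dist_int_def
  by (rule cInf_eq_minimum) (auto intro: round_diff_minimal)

lemma dist_int_le: "dist_int x \<le> \<bar>x - of_int m\<bar>"
  by (simp add: dist_int_eq_round round_diff_minimal)

definition MLPS2 :: "(real \<times> real) set"
  where "MLPS2 = {(d1, d2). d1 \<in> {0<..1/2} \<and> d2 \<in> {0<..1/2} \<and>
    (\<forall>s1 s2 :: nat. s1 > 0 \<longrightarrow> s2 > 0 \<longrightarrow> s1 \<noteq> s2 \<longrightarrow>
      (\<exists>t :: real. dist_int (real s1 * t) \<ge> d1 \<and> dist_int (real s2 * t) \<ge> d2))}"

end

theory Submission
  imports Defs
begin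

text \<open>
  The inequalities are forced by the speed pairs \<open>(1, 2)\<close> and \<open>(2, 1)\<close>: a number at distance
  \<open>x\<close> from the integers has its double at distance at most \<open>1 - 2 * x\<close> from them
  (\<open>dist_int_double\<close>).

  Conversely, divide out the common factor of the speeds (this only rescales time) and let
  \<open>a > b\<close> be the coprime speeds, with bounds \<open>d\<close> and \<open>e\<close>. If both are odd, both runners are at
  distance \<open>1/2\<close> at time \<open>1/2\<close>. Otherwise Bezout's identity gives odd \<open>m\<close>, \<open>n\<close> with
  \<open>a * m = b * n + 1\<close>. At time \<open>m / (2 * b)\<close> the slow runner is at \<open>m / 2\<close>, as far from the
  integers as possible, and the fast one is at \<open>n / 2 + 1 / (2 * b)\<close>, which may be too close to
  an integer (for \<open>b = 1\<close> it is an integer). Going back in time by \<open>d / (a * b)\<close>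
  moves the fast runner by \<open>d / b\<close> towards \<open>n / 2\<close>, which brings its distance up to
  \<open>1/2 - (1 - 2 * d) / (2 * b) \<ge> d\<close>. The slow runner loses only \<open>d / a \<le> d / 2\<close>, and
  \<open>1/2 - d / 2 \<ge> e\<close> is one of the two inequalities. The other one is used when the two runners
  change roles.
\<close>

lemma dist_int_double: "2 * dist_int t + dist_int (2 * t) \<le> 1"
proof -
  define r where "r = round t"
  have half: "\<bar>t - of_int r\<bar> \<le> 1 / 2"
    unfolding r_def using of_int_round_abs_le[of t] by (simp add: abs_minus_commute)
  have near: "dist_int t = \<bar>t - of_int r\<bar>"
    by (simp add: dist_int_eq_round r_def)
  have "dist_int (2 * t) \<le> \<bar>2 * t - of_int (2 * r + 1)\<bar>"
       "dist_int (2 * t) \<le> \<bar>2 * t - of_int (2 * r - 1)\<bar>"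
    by (rule dist_int_le)+
  then show ?thesis
    using half near by (auto simp: abs_if split: if_splits)
qed

text \<open>
  Odd multiples of \<open>1/2\<close> are at distance \<open>1/2\<close> from every integer, and the distance to the
  integers is 1-Lipschitz.
\<close>

lemma dist_int_near_half_odd:
  fixes n :: int
  assumes "odd n"
  shows "1 / 2 - \<bar>y\<bar> \<le> dist_int (of_int n / 2 + y)"
proof -
  define r where "r = round (of_int n / 2 + y)"
  have "n - 2 * r \<noteq> 0"
    using assms by auto
  then have "1 \<le> \<bar>real_of_int (n - 2 * r)\<bar>"
    by linarith
  then have "1 / 2 \<le> \<bar>real_of_int n / 2 - of_int r\<bar>"
    by (auto simp: abs_if split: if_splits)
  moreover have "dist_int (of_int n / 2 + y) = \<bar>of_int n / 2 + y - of_int r\<bar>"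
    by (simp add: dist_int_eq_round r_def)
  ultimately show ?thesis
    by linarith
qed

text \<open>
  The solutions of Bezout's identity are shifted by multiples of \<open>(b, a)\<close>. The odd one among
  \<open>a\<close>, \<open>b\<close> allows the parity of one unknown to be chosen, and the equation modulo 2 makes the
  other unknown odd.
\<close>

lemma bezout_odd:
  fixes a b :: int
  assumes "coprime a b" and "odd (a + b)"
  obtains m n where "odd m" "odd n" "a * m = b * n + 1"
proof -
  obtain x y where "x * a + y * b = 1"
    using bezout_int[of a b] assms(1) by auto
  then have xy: "a * x = b * (- y) + 1"
    by (simp add: algebra_simps)
  have shifted: "a * (x + b) = b * (a - y) + 1"
    using xy by (simp add: algebra_simps)
  have "even (a * x) \<longleftrightarrow> even (b * (- y) + 1)"
    using xy by simp
  then have "odd x \<and> odd y \<or> odd (x + b) \<and> odd (a - y)"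
    using assms(2) by auto
  then show thesis
    using that[OF _ _ xy] that[OF _ _ shifted] by auto
qed

lemma coprime_speeds_lonely:
  fixes a b :: int
  assumes "coprime a b" "0 < b" "b < a"
    and d: "0 \<le> d" "d \<le> 1 / 2" and e: "d + 2 * e \<le> 1"
  shows "\<exists>t. d \<le> dist_int (of_int a * t) \<and> e \<le> dist_int (of_int b * t)"
proof (cases "odd (a + b)")
  case False
  then have "odd a" "odd b"
    using assms(1) by (auto dest: coprime_common_divisor[of a b 2])
  then have "1 / 2 \<le> dist_int (of_int a * (1 / 2))" "1 / 2 \<le> dist_int (of_int b * (1 / 2))"
    using dist_int_near_half_odd[of a 0] dist_int_near_half_odd[of b 0] by auto
  moreover have "e \<le> 1 / 2"
    using d e by simp
  ultimately show ?thesis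
    using d(2) by (meson order_trans)
next
  case True
  obtain m n where "odd m" "odd n" and mn: "a * m = b * n + 1"
    using bezout_odd[OF assms(1) True] .
  have a: "2 \<le> real_of_int a" and b: "1 \<le> real_of_int b"
    using assms(2,3) by linarith+
  have mn': "real_of_int a * of_int m = of_int b * of_int n + 1"
    using arg_cong[OF mn, of real_of_int] by simp
  \<comment> \<open>Subtracting \<open>2 * d / a\<close> from \<open>m\<close> is the step back in time by \<open>d / (a * b)\<close>.\<close>
  define t where "t = (of_int m - 2 * d / of_int a) / (2 * of_int b)"
  have "of_int a * t = (of_int a * of_int m - 2 * d) / (2 * of_int b)"
    using a b by (simp add: t_def field_simps)
  also have "\<dots> = of_int n / 2 + (1 - 2 * d) / (2 * of_int b)"
    using b by (simp add: mn' field_simps)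
  finally have at: "of_int a * t = of_int n / 2 + (1 - 2 * d) / (2 * of_int b)" .
  have bt: "of_int b * t = of_int m / 2 + (- (d / of_int a))"
    using a b by (simp add: t_def field_simps)
  define y where "y = (1 - 2 * d) / (2 * of_int b)"
  have "y \<le> (1 - 2 * d) / 2"
    unfolding y_def using b d by (intro divide_left_mono) auto
  moreover have "0 \<le> y"
    unfolding y_def using b d by simp
  ultimately have "d \<le> 1 / 2 - \<bar>y\<bar>"
    by (simp add: field_simps)
  then have "d \<le> dist_int (of_int a * t)"
    using dist_int_near_half_odd[OF \<open>odd n\<close>, of y]
    unfolding at y_def[symmetric] by (rule order_trans)
  moreover have "d / of_int a \<le> d / 2"
    using a d by (intro divide_left_mono) auto
  then have "e \<le> dist_int (of_int b * t)"
    using dist_int_near_half_odd[OF \<open>odd m\<close>, of "- (d / of_int a)"] a d e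
    unfolding bt by simp
  ultimately show ?thesis
    by blast
qed

lemma speeds_lonely:
  fixes p q :: nat
  assumes "0 < q" "q < p" "0 \<le> d" "d \<le> 1 / 2" "d + 2 * e \<le> 1"
  shows "\<exists>t. d \<le> dist_int (real p * t) \<and> e \<le> dist_int (real q * t)"
proof -
  define g where "g = gcd p q"
  obtain a b where p: "p = a * g" and q: "q = b * g" and "coprime a b"
    using gcd_coprime_exists[of p q] assms(1) unfolding g_def by auto
  have "0 < g"
    using assms(1) by (simp add: g_def)
  moreover have "0 < b" "b < a"
    using assms(1,2) unfolding p q by auto
  ultimately obtain t where
    "d \<le> dist_int (real a * t)" "e \<le> dist_int (real b * t)"
    using coprime_speeds_lonely[of "int a" "int b" d e] \<open>coprime a b\<close> assms(3-5) by auto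
  then have "d \<le> dist_int (real p * (t / real g)) \<and> e \<le> dist_int (real q * (t / real g))"
    using \<open>0 < g\<close> by (simp add: p q)
  then show ?thesis
    by blast
qed

theorem theoremA:
  shows "MLPS2 = {(d1, d2). d1 \<in> {0<..1/2} \<and> d2 \<in> {0<..1/2} \<and>
    2 * d1 + d2 \<le> 1 \<and> d1 + 2 * d2 \<le> 1}"
proof -
  have necessary: "2 * d1 + d2 \<le> 1 \<and> d1 + 2 * d2 \<le> 1" if "(d1, d2) \<in> MLPS2" for d1 d2
  proof -
    have lonely: "\<exists>t. d1 \<le> dist_int (real s1 * t) \<and> d2 \<le> dist_int (real s2 * t)"
      if "0 < s1" "0 < s2" "s1 \<noteq> s2" for s1 s2 :: nat
      using that \<open>(d1, d2) \<in> MLPS2\<close> by (simp add: MLPS2_def)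
    obtain t where "d1 \<le> dist_int t" "d2 \<le> dist_int (2 * t)"
      using lonely[of 1 2] by auto
    moreover obtain u where "d1 \<le> dist_int (2 * u)" "d2 \<le> dist_int u"
      using lonely[of 2 1] by auto
    ultimately show ?thesis
      using dist_int_double[of t] dist_int_double[of u] by linarith
  qed
  have sufficient: "\<exists>t. d1 \<le> dist_int (real s1 * t) \<and> d2 \<le> dist_int (real s2 * t)"
    if "0 < d1" "d1 \<le> 1 / 2" "0 < d2" "d2 \<le> 1 / 2" "2 * d1 + d2 \<le> 1" "d1 + 2 * d2 \<le> 1"
      and "0 < s1" "0 < s2" "s1 \<noteq> s2" for d1 d2 :: real and s1 s2 :: nat
  proof (cases "s2 < s1")
    case True
    then show ?thesis
      using speeds_lonely[of s2 s1 d1 d2] that by auto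
  next
    case False
    then show ?thesis
      using speeds_lonely[of s1 s2 d2 d1] that by auto
  qed
  show ?thesis
  proof (intro set_eqI iffI; clarify)
    fix d1 d2 assume "(d1, d2) \<in> MLPS2"
    then show "d1 \<in> {0<..1/2} \<and> d2 \<in> {0<..1/2} \<and> 2 * d1 + d2 \<le> 1 \<and> d1 + 2 * d2 \<le> 1"
      using necessary[of d1 d2] by (simp add: MLPS2_def)
  next
    fix d1 d2 :: real
    assume "d1 \<in> {0<..1/2}" "d2 \<in> {0<..1/2}" "2 * d1 + d2 \<le> 1" "d1 + 2 * d2 \<le> 1"
    then show "(d1, d2) \<in> MLPS2"
      unfolding MLPS2_def using sufficient[of d1 d2] by simp
  qed
qed

end
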